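(* Let $k \geq 1$ be an integer, let $D = \{1,2,\dots,k-1\}$, let $S^* = \{0,k,2k,3k,\dots\}$, and let $S \subseteq \mathbb{N}$ be any $D$-avoiding set with $S \neq S^*$. Then $S_q \preceq S^*_q - \frac{1}{k} + O(1-q)$; that is, there exist a constant $C$ and $\epsilon > 0$ such that $S_q \leq S^*_q - \frac{1}{k} + C(1-q)$ for all $q \in (1-\epsilon,1)$.
   Context: A set $S \subseteq \mathbb{N}=\{0,1,2,\dots\}$ is $D$-avoiding if no two elements of $S$ differ by an element of $D$. For $S\subseteq\mathbb{N}$, $S_q := \sum_{n \in S} q^n$ for $q\in(-1,1)$. For real functions $f,g$ on $(0,1)$, $f\preceq g$ means there exists $\epsilon>0$ with $f(q)\le g(q)$ for all $q\in(1-\epsilon,1)$. *)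

theory Defs
  imports "HOL-Analysis.Analysis"
begin

definition avoiding :: "nat set \<Rightarrow> nat set \<Rightarrow> bool" where
  "avoiding D S \<longleftrightarrow> (\<forall>x\<in>S. \<forall>y\<in>S. x < y \<longrightarrow> y - x \<notin> D)"

definition gen :: "nat set \<Rightarrow> real \<Rightarrow> real" where
  "gen S q = (\<Sum>\<^sub>\<infinity>n\<in>S. q ^ n)"

text \<open>Functions on the interval $(0,1)$ are represented by total functions; any witness
  \<open>\<epsilon>\<close> can be shrunk below 1, so values outside $(0,1)$ are irrelevant.\<close>

definition preceq_near_1 :: "(real \<Rightarrow> real) \<Rightarrow> (real \<Rightarrow> real) \<Rightarrow> bool" (infix "\<preceq>" 50) where
  "f \<preceq> g \<longleftrightarrow> (\<exists>\<epsilon>>0. \<forall>q\<in>{1 - \<epsilon><..<1}. f q \<le> g q)"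

end

(*
  The map n \<mapsto> n div k is injective on S, so S_q is compared with S*_q block by block. If S misses
  block i, then S_q \<le> S*_q - q^(ik). Otherwise S meets every block, residues mod k are nondecreasing
  along S, and from some block i on they are positive; so from there on every term loses a factor q,
  a total loss of (1-q) q^(ik) / (1-q^k). By Bernoulli, 1 - q^k \<le> k(1-q) and
  q^(ik) \<ge> 1 - ik(1-q), so either loss is at least 1/k - i(1-q).
*)
theory Submission imports Defs begin

lemma avoidingD:
  assumes "avoiding {1..k - 1} S" "x \<in> S" "y \<in> S" "x < y"
  shows "k \<le> y - x"
  using assms unfolding avoiding_def by fastforce

text \<open>Distinct elements of \<open>S\<close> are at least \<open>k\<close> apart, and adding
  \<open>k\<close> to the smaller one already carries it into the next block.\<close>

lemma avoiding_inj_on_div: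
  assumes "k \<ge> 1" "avoiding {1..k - 1} S"
  shows "inj_on (\<lambda>n. n div k) S"
proof -
  have *: False if "x \<in> S" "y \<in> S" "x < y" "x div k = y div k" for x y
  proof -
    have "x + k \<le> y"
      using avoidingD[OF assms(2) that(1-3)] that(3) by linarith
    then have "(x + k) div k \<le> y div k"
      by (rule div_le_mono)
    then show False
      using assms(1) that(4) by simp
  qed
  show ?thesis
  proof (rule inj_onI)
    fix x y assume "x \<in> S" "y \<in> S" "x div k = y div k"
    then show "x = y"
      using *[of x y] *[of y x] by (cases x y rule: linorder_cases) auto
  qed
qed

text \<open>Induction over blocks: an element of block \<open>j\<close> with positive residue lies
  less than \<open>k\<close> below the multiple \<open>k * (j + 1)\<close>, which is thereby
  excluded from \<open>S\<close>. \<open>meets\<close> supplies such an element in each block, so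
  the chain does not break.\<close>

lemma avoiding_mod_pos_propagates:
  assumes "k \<ge> 1" "avoiding {1..k - 1} S"
    and meets: "\<And>j. \<exists>n\<in>S. n div k = j"
    and s: "s \<in> S" "s mod k \<noteq> 0"
    and n: "n \<in> S" "s div k \<le> n div k"
  shows "n mod k \<noteq> 0"
proof -
  have "\<forall>n\<in>S. n div k = j \<longrightarrow> n mod k \<noteq> 0" if "s div k \<le> j" for j
    using that
  proof (induction j rule: dec_induct)
    \<comment> \<open>By injectivity \<open>s\<close> is the only element of \<open>S\<close> in its
      block.\<close>
    case base
    then show ?case
      using avoiding_inj_on_div[OF assms(1,2)] s by (metis inj_onD)
  next
    case (step j)
    show ?case
    proof (intro ballI impI notI)
      fix n assume n: "n \<in> S" "n div k = Suc j" "n mod k = 0"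
      obtain m where m: "m \<in> S" "m div k = j"
        using meets by blast
      have n_eq: "n = k * j + k"
        using n(2,3) div_mult_mod_eq[of n k] by (simp add: algebra_simps)
      have m_eq: "m = k * j + m mod k"
        using m(2) div_mult_mod_eq[of m k] by (simp add: algebra_simps)
      have "m mod k < k" "m mod k \<noteq> 0"
        using assms(1) step.IH m by auto
      then have "m < n" "n - m < k"
        using n_eq m_eq by linarith+
      then show False
        using avoidingD[OF assms(2) m(1) n(1)] by simp
    qed
  qed
  then show ?thesis
    using n by blast
qed

text \<open>Comparison principle for both cases: \<open>f\<close> will be
  \<open>\<lambda>n. n div k\<close> and \<open>g j\<close> a bound for the term from block
  \<open>j\<close>. Injectivity charges each \<open>g j\<close> at most once; nonnegativity pays for
  the blocks that \<open>S\<close> misses.\<close>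

lemma gen_le_by_blocks:
  fixes q :: real
  assumes "0 < q" "inj_on f S" "(g has_sum T) UNIV"
    and nonneg: "\<And>j. 0 \<le> g j"
    and le: "\<And>n. n \<in> S \<Longrightarrow> q ^ n \<le> g (f n)"
  shows "gen S q \<le> T"
proof -
  have sg: "g summable_on A" for A
    using has_sum_imp_summable[OF assms(3)] by (rule summable_on_subset_banach) simp
  have s: "(\<lambda>n. g (f n)) summable_on S"
    using summable_on_reindex[OF assms(2), of g] sg by (simp add: o_def)
  have "gen S q \<le> (\<Sum>\<^sub>\<infinity>n\<in>S. g (f n))"
    unfolding gen_def
  proof (rule infsum_mono)
    show "(\<lambda>n. q ^ n) summable_on S"
      using s by (rule summable_on_comparison_test) (use assms(1) le in auto)
  qed (use s le in auto)
  also have "\<dots> = infsum g (f ` S)"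
    using infsum_reindex[OF assms(2), of g] by (simp add: o_def)
  also have "\<dots> \<le> infsum g UNIV"
    by (rule infsum_mono_neutral) (use sg nonneg in auto)
  also have "\<dots> = T"
    using assms(3) by (rule infsumI)
  finally show ?thesis .
qed

lemma has_sum_diff:
  fixes f g :: "'a \<Rightarrow> 'b::real_normed_vector"
  assumes "(f has_sum a) A" "(g has_sum b) A"
  shows "((\<lambda>x. f x - g x) has_sum (a - b)) A"
  using has_sum_add[OF assms(1), of "\<lambda>x. - g x" "- b"] assms(2) by (simp add: has_sum_uminus)

lemma has_sum_power_mult:
  fixes q :: real
  assumes "0 < q" "q < 1" "k \<ge> 1"
  shows "((\<lambda>j. q ^ (k * j)) has_sum (1 / (1 - q ^ k))) UNIV"
proof -
  have "q ^ k < 1"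
    using assms by (simp add: power_less_one_iff)
  then have "(\<lambda>j. q ^ (k * j)) sums (1 / (1 - q ^ k))"
    unfolding power_mult using geometric_sums[of "q ^ k"] assms(1) by simp
  then show ?thesis
    by (rule sums_nonneg_imp_has_sum) (use assms in auto)
qed

lemma gen_multiples:
  fixes q :: real
  assumes "0 < q" "q < 1" "k \<ge> 1"
  shows "gen {i * k | i. True} q = 1 / (1 - q ^ k)"
proof -
  have "{i * k | i. True} = range ((*) k)"
    by (auto simp: mult.commute)
  moreover have "inj ((*) k)"
    using assms(3) by (auto intro: injI)
  ultimately show ?thesis
    unfolding gen_def
    using infsum_reindex[of "(*) k" UNIV "\<lambda>n. q ^ n"] infsumI[OF has_sum_power_mult[OF assms]]
    by (simp add: o_def)
qed

text \<open>The tail is padded with zeros to a series over \<open>UNIV\<close>, so that it can be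
  subtracted termwise from the full geometric series.\<close>

lemma has_sum_power_mult_tail:
  fixes q :: real
  assumes "0 < q" "q < 1" "k \<ge> 1"
  shows "((\<lambda>j. if i \<le> j then q ^ (k * j) else 0) has_sum (q ^ (k * i) / (1 - q ^ k))) UNIV"
proof -
  have "((\<lambda>j. q ^ (k * i) * q ^ (k * j)) has_sum (q ^ (k * i) * (1 / (1 - q ^ k)))) UNIV"
    by (intro has_sum_cmult_right has_sum_power_mult assms)
  then have "((\<lambda>j. q ^ (k * j)) has_sum (q ^ (k * i) / (1 - q ^ k))) (range ((+) i))"
    by (subst has_sum_reindex) (auto simp: o_def power_add distrib_left)
  then show ?thesis
    by (rule has_sum_cong_neutral[THEN iffD1, rotated -1])
       (auto simp: image_iff le_iff_add)
qed

lemma one_minus_power_le: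
  fixes q :: real
  assumes "0 < q"
  shows "1 - q ^ n \<le> real n * (1 - q)"
  using Bernoulli_inequality[of "q - 1" n] assms by (simp add: algebra_simps)

text \<open>Bernoulli with exponent \<open>k * i\<close>: dividing by \<open>k\<close> cancels the
  factor \<open>k\<close> in the error, which leaves slope \<open>i\<close>.\<close>

lemma power_mult_div_ge:
  fixes q :: real
  assumes "0 < q" "q < 1" "k \<ge> 1"
  shows "1 / real k - real i * (1 - q) \<le> q ^ (k * i) / real k"
proof -
  have "1 - real (k * i) * (1 - q) \<le> q ^ (k * i)"
    using one_minus_power_le[OF assms(1), of "k * i"] by linarith
  then have "(1 - real (k * i) * (1 - q)) / real k \<le> q ^ (k * i) / real k"
    by (rule divide_right_mono) simp
  then show ?thesis
    using assms(3) by (simp add: diff_divide_distrib)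
qed

text \<open>Each \<open>n\<close> is at least \<open>k * (n div k)\<close>, so
  \<open>q ^ (k * j)\<close> bounds the term of block \<open>j\<close>, and the bound for block
  \<open>i\<close> can be lowered to 0.\<close>

lemma gen_le_missed_block:
  fixes q :: real
  assumes "k \<ge> 1" "avoiding {1..k - 1} S" "0 < q" "q < 1"
    and missed: "\<And>n. n \<in> S \<Longrightarrow> n div k \<noteq> i"
  shows "gen S q \<le> 1 / (1 - q ^ k) - q ^ (k * i) / real k"
proof -
  have "((\<lambda>j. q ^ (k * j) - (if j = i then q ^ (k * i) else 0))
          has_sum (1 / (1 - q ^ k) - q ^ (k * i))) UNIV"
  proof (intro has_sum_diff has_sum_power_mult assms)
    have "((\<lambda>j. q ^ (k * i)) has_sum q ^ (k * i)) {i}"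
      using has_sum_finite[of "{i}" "\<lambda>j. q ^ (k * i)"] by simp
    then show "((\<lambda>j. if j = i then q ^ (k * i) else 0) has_sum q ^ (k * i)) UNIV"
      by (rule has_sum_cong_neutral[THEN iffD1, rotated -1]) auto
  qed
  then have "gen S q \<le> 1 / (1 - q ^ k) - q ^ (k * i)"
  proof (rule gen_le_by_blocks[OF assms(3) avoiding_inj_on_div[OF assms(1,2)]])
    show "q ^ n \<le> q ^ (k * (n div k)) - (if n div k = i then q ^ (k * i) else 0)"
      if "n \<in> S" for n
      using missed[OF that] assms(3,4) by (simp add: power_decreasing)
  qed (use assms(3) in auto)
  \<comment> \<open>The factor \<open>1 / k\<close> gives away part of the loss, to match the form
    of the bound in the shifted case.\<close>
  moreover have "q ^ (k * i) / real k \<le> q ^ (k * i)"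
    using assms(1,3) by (simp add: divide_le_eq)
  ultimately show ?thesis
    by linarith
qed

lemma gen_le_shifted_tail:
  fixes q :: real
  assumes "k \<ge> 1" "avoiding {1..k - 1} S" "0 < q" "q < 1"
    and shifted: "\<And>n. n \<in> S \<Longrightarrow> i \<le> n div k \<Longrightarrow> n mod k \<noteq> 0"
  shows "gen S q \<le> 1 / (1 - q ^ k) - q ^ (k * i) / real k"
proof -
  \<comment> \<open>From block \<open>i\<close> on the bound is \<open>q * q ^ (k * j)\<close>,
    written as a difference so that its sum is a difference of two known series.\<close>
  have "((\<lambda>j. q ^ (k * j) - (1 - q) * (if i \<le> j then q ^ (k * j) else 0))
          has_sum (1 / (1 - q ^ k) - (1 - q) * (q ^ (k * i) / (1 - q ^ k)))) UNIV"
    by (intro has_sum_diff has_sum_cmult_right has_sum_power_mult has_sum_power_mult_tail assms)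
  then have "gen S q \<le> 1 / (1 - q ^ k) - (1 - q) * (q ^ (k * i) / (1 - q ^ k))"
  proof (rule gen_le_by_blocks[OF assms(3) avoiding_inj_on_div[OF assms(1,2)]])
    fix n assume n: "n \<in> S"
    show "q ^ n \<le> q ^ (k * (n div k)) - (1 - q) * (if i \<le> n div k then q ^ (k * (n div k)) else 0)"
    proof (cases "i \<le> n div k")
      case True
      then have "Suc (k * (n div k)) \<le> n"
        using shifted[OF n] mult_div_mod_eq[of k n] by linarith
      then have "q ^ n \<le> q ^ Suc (k * (n div k))"
        using assms(3,4) by (intro power_decreasing) auto
      then show ?thesis
        using True by (simp add: algebra_simps)
    next
      case False
      then show ?thesis
        using assms(3,4) by (simp add: power_decreasing)
    qed
  qed (use assms(3,4) in \<open>auto simp: algebra_simps\<close>)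
  moreover have "q ^ (k * i) / real k \<le> (1 - q) * (q ^ (k * i) / (1 - q ^ k))"
  proof -
    have "0 < 1 - q ^ k"
      using assms by (simp add: power_less_one_iff)
    then have "1 / real k \<le> (1 - q) / (1 - q ^ k)"
      using one_minus_power_le[OF assms(3), of k] assms(1) by (simp add: field_simps)
    then have "q ^ (k * i) * (1 / real k) \<le> q ^ (k * i) * ((1 - q) / (1 - q ^ k))"
      by (rule mult_left_mono) (use assms(3) in simp)
    then show ?thesis
      by (simp add: mult.commute)
  qed
  ultimately show ?thesis
    by linarith
qed

theorem theorem8:
  fixes k :: nat and D S Sstar :: "nat set"
  assumes "k \<ge> 1"
    and "D = {1..k - 1}"
    and "Sstar = {i * k | i. True}"
    and "avoiding D S"
    and "S \<noteq> Sstar"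
  shows "\<exists>C::real. gen S \<preceq> (\<lambda>q. gen Sstar q - 1 / real k + C * (1 - q))"
proof -
  have av: "avoiding {1..k - 1} S"
    using assms by simp
  \<comment> \<open>The index \<open>i\<close> must not depend on \<open>q\<close>, since it becomes
    the constant \<open>C\<close>. It is a missed block or, if there is none, the block of some
    \<open>s\<close> with positive residue.\<close>
  obtain i where i: "\<And>q::real. 0 < q \<Longrightarrow> q < 1 \<Longrightarrow>
      gen S q \<le> 1 / (1 - q ^ k) - q ^ (k * i) / real k"
  proof (cases "\<exists>i. \<forall>n\<in>S. n div k \<noteq> i")
    case True
    then obtain i where "\<forall>n\<in>S. n div k \<noteq> i"
      by blast
    then show thesis
      using that[of i] gen_le_missed_block[OF assms(1) av] by blast
  next
    case False
    then have meets: "\<exists>n\<in>S. n div k = j" for j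
      by blast
    \<comment> \<open>If all residues vanish, the element in block \<open>j\<close> is
      \<open>j * k\<close>; as every block is met, \<open>S\<close> would equal
      \<open>Sstar\<close>.\<close>
    have "\<exists>s\<in>S. s mod k \<noteq> 0"
    proof (rule ccontr)
      assume "\<not> (\<exists>s\<in>S. s mod k \<noteq> 0)"
      then have eq: "n = n div k * k" if "n \<in> S" for n
        using that by (metis add.right_neutral div_mult_mod_eq)
      then have "S \<subseteq> Sstar"
        unfolding assms(3) by blast
      moreover have "Sstar \<subseteq> S"
      proof
        fix m assume "m \<in> Sstar"
        then obtain j where "m = j * k"
          unfolding assms(3) by blast
        then show "m \<in> S"
          using meets[of j] eq by metis
      qed
      ultimately show False
        using assms(5) by blast
    qed
    then obtain s where "s \<in> S" "s mod k \<noteq> 0"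
      by blast
    then show thesis
      using that[of "s div k"] gen_le_shifted_tail[OF assms(1) av]
        avoiding_mod_pos_propagates[OF assms(1) av meets] by blast
  qed
  have "gen S q \<le> gen Sstar q - 1 / real k + real i * (1 - q)" if "0 < q" "q < 1" for q
    using i[OF that] power_mult_div_ge[OF that assms(1), of i] gen_multiples[OF that assms(1)]
    unfolding assms(3) by linarith
  \<comment> \<open>The bound holds on all of (0,1), so \<epsilon> = 1 serves.\<close>
  then show ?thesis
    unfolding preceq_near_1_def by (intro exI[of _ "real i"] exI[of _ 1]) auto
qed

end
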